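(* Let $K$ be a nonempty closed and convex subset of a uniformly convex hyperbolic space $X$ with monotone modulus of uniform convexity $\eta$, and let $T_i:K\to K$, $i=1,\dots,m$, be a finite family of uniformly continuous total asymptotically nonexpansive mappings with sequences $\{k_{in}\}_{n\ge1}$, $\{\varphi_{in}\}_{n\ge1}$ and functions $\xi_i$. Suppose that $F:=\bigcap_{i=1}^mF(T_i)\ne\emptyset$ and that for each $i=1,\dots,m$: (C1) $\sum_{n=1}^\infty k_{in}<\infty$ and $\sum_{n=1}^\infty\varphi_{in}<\infty$; (C2) there exist constants $M_i,M_i^*>0$ such that $\xi_i(\lambda)\le M_i^*\lambda$ for all $\lambda\ge M_i$. Let $\{\alpha_n\}_{n\ge1}$ be a sequence in $[0,1]$ bounded away from $0$ and $1$, let $x_1\in K$ and let $\{x_n\}$ be defined, for $n\ge1$, by $x_{n+1}=W(x_n,T_1^nx_n,\alpha_n)$ if $m=1$, and, if $m\ge2$, by $$x_{n+1}=W(x_n,T_1^ny_{1n},\alpha_n),\quad y_{jn}=W(x_n,T_{j+1}^ny_{(j+1)n},\alpha_n)\ (1\le j\le m-2),\quad y_{(m-1)n}=W(x_n,T_m^nx_n,\alpha_n).$$ Then $\{x_n\}$ converges strongly (i.e. in the metric $d$) to a common fixed point in $F$ if and only if $\liminf_{n\to\infty}d(x_n,F)=0$.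
   Context: A hyperbolic space (in the sense of Kohlenbach) is a metric space $(X,d)$ together with a mapping $W:X^2\times[0,1]\to X$ such that for all $u,x,y,z,w\in X$ and $\alpha,\beta\in[0,1]$: (W1) $d(u,W(x,y,\alpha))\le(1-\alpha)d(u,x)+\alpha d(u,y)$; (W2) $d(W(x,y,\alpha),W(x,y,\beta))=|\alpha-\beta|\,d(x,y)$; (W3) $W(x,y,\alpha)=W(y,x,1-\alpha)$; (W4) $d(W(x,z,\alpha),W(y,w,\alpha))\le(1-\alpha)d(x,y)+\alpha d(z,w)$. A subset $K\subseteq X$ is convex if $W(x,y,\alpha)\in K$ for all $x,y\in K$, $\alpha\in[0,1]$. $(X,d,W)$ is uniformly convex if for all $r>0$ and $\epsilon\in(0,2]$ there is $\delta\in(0,1]$ such that for all $u,x,y\in X$ with $d(x,u)\le r$, $d(y,u)\le r$ and $d(x,y)\ge\epsilon r$ one has $d(W(x,y,\tfrac12),u)\le(1-\delta)r$. A function $\eta:(0,\infty)\times(0,2]\to(0,1]$ giving such a $\delta=\eta(r,\epsilon)$ for every $r,\epsilon$ is a modulus of uniform convexity; it is monotone if $\eta(r_2,\epsilon)\le\eta(r_1,\epsilon)$ whenever $r_2\ge r_1>0$ and $\epsilon\in(0,2]$. A mapping $T:K\to K$ is total asymptotically nonexpansive, with sequences $\{k_n\},\{\varphi_n\}$ and function $\xi$, if $\{k_n\},\{\varphi_n\}$ are nonnegative real sequences with $k_n\to0$, $\varphi_n\to0$ and $\xi:\mathbb{R}^+\to\mathbb{R}^+$ (where $\mathbb{R}^+=[0,\infty)$)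 is a strictly increasing continuous function with $\xi(0)=0$ such that $d(T^nx,T^ny)\le d(x,y)+k_n\xi(d(x,y))+\varphi_n$ for all $x,y\in K$ and $n\ge1$. $F(T)$ denotes the set of fixed points of $T$, and $d(x,F)=\inf_{p\in F}d(x,p)$. "Bounded away from $0$ and $1$" means there are $a,b\in(0,1)$ with $\alpha_n\in[a,b]$ for all $n$.
   Formalization: The space X is additionally assumed to be complete; without completeness the "if" direction fails, since the iterates can be Cauchy with d(x_n,F) tending to 0 while their limit is missing from X. *)

theory Defs
  imports "HOL-Analysis.Analysis"
begin

text \<open>The space \<open>X\<close> is the whole carrier type.  The mapping \<open>W\<close> is a total function; only its
  values for parameters in \<open>[0,1]\<close> are constrained.  As in Kohlenbach's definition, \<open>X\<close>
  need not be complete; completeness is stated separately where it is used.\<close>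

locale hyperbolic_space =
  fixes W :: "'a::metric_space \<Rightarrow> 'a \<Rightarrow> real \<Rightarrow> 'a"
  assumes W1: "\<alpha> \<in> {0..1} \<Longrightarrow>
      dist u (W x y \<alpha>) \<le> (1 - \<alpha>) * dist u x + \<alpha> * dist u y"
    and W2: "\<alpha> \<in> {0..1} \<Longrightarrow> \<beta> \<in> {0..1} \<Longrightarrow>
      dist (W x y \<alpha>) (W x y \<beta>) = \<bar>\<alpha> - \<beta>\<bar> * dist x y"
    and W3: "\<alpha> \<in> {0..1} \<Longrightarrow> W x y \<alpha> = W y x (1 - \<alpha>)"
    and W4: "\<alpha> \<in> {0..1} \<Longrightarrow>
      dist (W x z \<alpha>) (W y w \<alpha>) \<le> (1 - \<alpha>) * dist x y + \<alpha> * dist z w"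

definition W_convex :: "('a \<Rightarrow> 'a \<Rightarrow> real \<Rightarrow> 'a) \<Rightarrow> 'a set \<Rightarrow> bool" where
  "W_convex W K \<longleftrightarrow> (\<forall>x\<in>K. \<forall>y\<in>K. \<forall>\<alpha>\<in>{0..1}. W x y \<alpha> \<in> K)"

definition convexity_gap ::
  "('a::metric_space \<Rightarrow> 'a \<Rightarrow> real \<Rightarrow> 'a) \<Rightarrow> real \<Rightarrow> real \<Rightarrow> real \<Rightarrow> bool" where
  "convexity_gap W r \<epsilon> \<delta> \<longleftrightarrow> \<delta> \<in> {0<..1} \<and>
     (\<forall>u x y. dist x u \<le> r \<longrightarrow> dist y u \<le> r \<longrightarrow> dist x y \<ge> \<epsilon> * r \<longrightarrow>
        dist (W x y (1/2)) u \<le> (1 - \<delta>) * r)"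

definition uniformly_convex :: "('a::metric_space \<Rightarrow> 'a \<Rightarrow> real \<Rightarrow> 'a) \<Rightarrow> bool" where
  "uniformly_convex W \<longleftrightarrow> (\<forall>r>0. \<forall>\<epsilon>\<in>{0<..2}. \<exists>\<delta>. convexity_gap W r \<epsilon> \<delta>)"

definition modulus_of_uniform_convexity ::
  "('a::metric_space \<Rightarrow> 'a \<Rightarrow> real \<Rightarrow> 'a) \<Rightarrow> (real \<Rightarrow> real \<Rightarrow> real) \<Rightarrow> bool" where
  "modulus_of_uniform_convexity W \<eta> \<longleftrightarrow>
     (\<forall>r>0. \<forall>\<epsilon>\<in>{0<..2}. convexity_gap W r \<epsilon> (\<eta> r \<epsilon>))"

definition monotone_modulus :: "(real \<Rightarrow> real \<Rightarrow> real) \<Rightarrow> bool" where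
  "monotone_modulus \<eta> \<longleftrightarrow>
     (\<forall>r1 r2 \<epsilon>. 0 < r1 \<longrightarrow> r1 \<le> r2 \<longrightarrow> \<epsilon> \<in> {0<..2} \<longrightarrow> \<eta> r2 \<epsilon> \<le> \<eta> r1 \<epsilon>)"

text \<open>Sequences are indexed from \<open>1\<close>; their values at \<open>0\<close> are never constrained.\<close>

definition total_asymptotically_nonexpansive_on ::
  "'a::metric_space set \<Rightarrow> ('a \<Rightarrow> 'a) \<Rightarrow> (nat \<Rightarrow> real) \<Rightarrow> (nat \<Rightarrow> real) \<Rightarrow> (real \<Rightarrow> real) \<Rightarrow> bool"
where
  "total_asymptotically_nonexpansive_on K T k \<phi> \<xi> \<longleftrightarrow>
     T \<in> K \<rightarrow> K \<and>
     (\<forall>n\<ge>1. k n \<ge> 0) \<and> (\<forall>n\<ge>1. \<phi> n \<ge> 0) \<and> k \<longlonglongrightarrow> 0 \<and> \<phi> \<longlonglongrightarrow> 0 \<and>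
     \<xi> \<in> {0..} \<rightarrow> {0..} \<and> strict_mono_on {0..} \<xi> \<and> continuous_on {0..} \<xi> \<and> \<xi> 0 = 0 \<and>
     (\<forall>x\<in>K. \<forall>y\<in>K. \<forall>n\<ge>1.
        dist ((T ^^ n) x) ((T ^^ n) y) \<le> dist x y + k n * \<xi> (dist x y) + \<phi> n)"

definition fixed_points_on :: "'a set \<Rightarrow> ('a \<Rightarrow> 'a) \<Rightarrow> 'a set" where
  "fixed_points_on K T = {p \<in> K. T p = p}"

end

theory Submission
  imports Defs
begin

text \<open>By (C2), \<open>\<xi>\<^sub>i\<close> is dominated by an affine function, so for \<open>p \<in> F\<close> each \<open>T\<^sub>i\<^sup>n\<close> satisfies
  \<open>d(T\<^sub>i\<^sup>n u, p) \<le> (1 + s\<^sub>n) d(u, p) + e\<^sub>n\<close> with summable \<open>s\<close>, \<open>e\<close> that do not depend on \<open>p\<close> or \<open>i\<close>.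
  Passing through the \<open>m\<close> nested convex combinations gives
  \<open>d(x\<^sub>n\<^sub>+\<^sub>1, p) \<le> (1 + s\<^sub>n)\<^sup>m (d(x\<^sub>n, p) + m e\<^sub>n)\<close>.  Hence once \<open>x\<^sub>n\<close> is near some \<open>p \<in> F\<close> for a large
  \<open>n\<close>, all later iterates stay near that same \<open>p\<close>; if \<open>liminf d(x\<^sub>n, F) = 0\<close>, the sequence is therefore
  Cauchy, and its limit lies in the closed set \<open>F\<close>.\<close>

text \<open>Unrolling the recursion multiplies the factors, and writing them as exponentials turns
  the product into a sum of exponents. Each new error \<open>c (n + j)\<close> can be moved under
  the accumulated factor because that factor is at least 1.\<close>

lemma quasi_fejer_iterate:
  fixes z :: "nat \<Rightarrow> 'a::metric_space"
  assumes step: "\<And>n. dist (z (Suc n)) p \<le> exp (a n) * (dist (z n) p + c n)"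
    and a: "\<And>n. 0 \<le> a n" and c: "\<And>n. 0 \<le> c n"
  shows "dist (z (n + j)) p \<le> exp (\<Sum>i=n..<n+j. a i) * (dist (z n) p + (\<Sum>i=n..<n+j. c i))"
proof (induction j)
  case 0
  then show ?case by simp
next
  case (Suc j)
  let ?A = "\<Sum>i=n..<n+j. a i" and ?C = "\<Sum>i=n..<n+j. c i"
  have "0 \<le> ?A" by (simp add: a sum_nonneg)
  then have "c (n + j) \<le> exp ?A * c (n + j)"
    using mult_right_mono[of 1 "exp ?A" "c (n + j)"] c by simp
  with Suc have "dist (z (n + j)) p + c (n + j) \<le> exp ?A * (dist (z n) p + (?C + c (n + j)))"
    by (simp add: algebra_simps)
  then have "exp (a (n + j)) * (dist (z (n + j)) p + c (n + j))
      \<le> exp (a (n + j)) * (exp ?A * (dist (z n) p + (?C + c (n + j))))"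
    by (intro mult_left_mono) auto
  with step[of "n + j"]
  have "dist (z (Suc (n + j))) p
      \<le> exp (a (n + j)) * (exp ?A * (dist (z n) p + (?C + c (n + j))))"
    by (rule order_trans)
  then show ?case
    by (simp add: exp_add mult_ac add_ac)
qed

text \<open>Since \<open>a\<close> and \<open>c\<close> are common to all p \<in> F, the centre p
  may be chosen after the index \<open>n\<close>. This is why coming close to the set F, rather than
  to one fixed point of it, suffices.\<close>

lemma quasi_fejer_Cauchy:
  fixes z :: "nat \<Rightarrow> 'a::metric_space"
  assumes step: "\<And>n p. p \<in> F \<Longrightarrow> dist (z (Suc n)) p \<le> exp (a n) * (dist (z n) p + c n)"
    and a: "\<And>n. 0 \<le> a n" "summable a" and c: "\<And>n. 0 \<le> c n" "summable c"
    and "F \<noteq> {}"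
    and near: "\<And>\<epsilon> N. \<epsilon> > 0 \<Longrightarrow> \<exists>n\<ge>N. infdist (z n) F < \<epsilon>"
  shows "Cauchy z"
proof (rule metric_CauchyI)
  fix \<epsilon> :: real assume "\<epsilon> > 0"
  define B where "B = exp (suminf a)"
  \<comment> \<open>All growth factors are at most \<open>B\<close>. The distance at the starting
    index and the later errors each contribute less than \<open>B * \<delta>\<close>, hence together
    less than \<epsilon>/2, and two tail terms are compared through p.\<close>
  define \<delta> where "\<delta> = \<epsilon> / (4 * B)"
  have B: "B > 0" by (simp add: B_def)
  with \<open>\<epsilon> > 0\<close> have "\<delta> > 0" by (simp add: \<delta>_def)
  obtain N where N: "\<And>m n. m \<ge> N \<Longrightarrow> \<bar>sum c {m..<n}\<bar> < \<delta>"
    using c(2) \<open>\<delta> > 0\<close> unfolding summable_Cauchy real_norm_def by meson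
  obtain n where n: "n \<ge> N" "infdist (z n) F < \<delta>"
    using near \<open>\<delta> > 0\<close> by blast
  then obtain p where p: "p \<in> F" "dist (z n) p < \<delta>"
    using \<open>F \<noteq> {}\<close> by (auto simp: infdist_notempty cINF_less_iff)
  have close: "dist (z (n + j)) p < \<epsilon> / 2" for j
  proof -
    have "(\<Sum>i=n..<n+j. a i) \<le> suminf a"
      by (rule sum_le_suminf) (use a in auto)
    then have "exp (\<Sum>i=n..<n+j. a i) \<le> B" by (simp add: B_def)
    moreover have "(\<Sum>i=n..<n+j. c i) \<ge> 0" by (simp add: c sum_nonneg)
    ultimately have "dist (z (n + j)) p \<le> B * (dist (z n) p + (\<Sum>i=n..<n+j. c i))"
      using quasi_fejer_iterate[of z p a c n j, OF step[OF p(1)] a(1) c(1)]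
      by (smt (verit) mult_right_mono zero_le_dist)
    also have "\<dots> < B * (\<delta> + \<delta>)"
      using N[OF n(1), of "n + j"] p(2) B by (intro mult_strict_left_mono) auto
    also have "\<dots> = \<epsilon> / 2" using B by (simp add: \<delta>_def)
    finally show ?thesis .
  qed
  have "dist (z i) (z j) < \<epsilon>" if "i \<ge> n" "j \<ge> n" for i j
    using close[of "i - n"] close[of "j - n"] that dist_triangle2[of "z i" "z j" p] by simp
  then show "\<exists>M. \<forall>i\<ge>M. \<forall>j\<ge>M. dist (z i) (z j) < \<epsilon>" by blast
qed

text \<open>In the application \<open>v m\<close> is the current iterate and \<open>v 0\<close> the
  next one, so the induction on \<open>l\<close> runs from the innermost combination outwards. Each
  level applies one mapping, which costs a factor \<open>1 + s\<close> and one more error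
  \<open>e\<close>.\<close>

lemma (in hyperbolic_space) nested_Mann_estimate:
  assumes K: "W_convex W K" "v m \<in> K"
    and t: "t \<in> {0..1}" and s: "0 \<le> s" and e: "0 \<le> e"
    and rec: "\<And>j. j < m \<Longrightarrow> v j = W (v m) (S (Suc j) (v (Suc j))) t"
    and S_K: "\<And>j u. j < m \<Longrightarrow> u \<in> K \<Longrightarrow> S (Suc j) u \<in> K"
    and S_p: "\<And>j u. j < m \<Longrightarrow> u \<in> K \<Longrightarrow> dist (S (Suc j) u) p \<le> (1 + s) * dist u p + e"
    and "l \<le> m"
  shows "v (m - l) \<in> K \<and> dist (v (m - l)) p \<le> (1 + s) ^ l * (dist (v m) p + real l * e)"
  using \<open>l \<le> m\<close>
proof (induction l)
  case 0
  then show ?case using K by simp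
next
  case (Suc l)
  define j where "j = m - Suc l"
  have j: "j < m" "m - l = Suc j" using Suc.prems by (auto simp: j_def)
  have IH: "v (Suc j) \<in> K"
      "dist (v (Suc j)) p \<le> (1 + s) ^ l * (dist (v m) p + real l * e)"
    using Suc j by auto
  let ?u = "S (Suc j) (v (Suc j))"
  let ?R = "(1 + s) ^ Suc l * (dist (v m) p + real (Suc l) * e)"
  have pow: "(1 + s) ^ Suc l \<ge> 1" using s by (simp only: one_le_power)
  have "dist ?u p \<le> (1 + s) * dist (v (Suc j)) p + e"
    by (rule S_p[OF j(1) IH(1)])
  \<comment> \<open>The fresh error \<open>e\<close> is enlarged by a power that is at least 1, so
    that it fits under the common factor of \<open>?R\<close>.\<close>
  also have "\<dots> \<le> (1 + s) * ((1 + s) ^ l * (dist (v m) p + real l * e)) + (1 + s) ^ Suc l * e"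
    using s IH(2) pow e mult_right_mono[of 1 "(1 + s) ^ Suc l" e]
    by (intro add_mono mult_left_mono) auto
  also have "\<dots> = ?R" by (simp add: algebra_simps)
  finally have u: "dist ?u p \<le> ?R" .
  have "dist (v m) p \<le> 1 * (dist (v m) p + real (Suc l) * e)" using e by simp
  also have "\<dots> \<le> ?R" using pow e by (intro mult_right_mono) auto
  finally have x: "dist (v m) p \<le> ?R" .
  \<comment> \<open>Both endpoints of the combination are within \<open>?R\<close> of p, so by
    \<open>W1\<close> the combination is too.\<close>
  have "dist (v j) p \<le> (1 - t) * dist (v m) p + t * dist ?u p"
    using W1[OF t, of p "v m" ?u] rec[OF j(1)] by (simp add: dist_commute)
  also have "\<dots> \<le> (1 - t) * ?R + t * ?R"
    using t u x by (intro add_mono mult_left_mono) auto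
  also have "\<dots> = ?R" by (simp add: left_diff_distrib)
  finally have "dist (v j) p \<le> ?R" .
  moreover have "v j \<in> K"
    using rec[OF j(1)] K t S_K[OF j(1) IH(1)] by (simp add: W_convex_def)
  ultimately show ?case by (simp only: j_def)
qed

lemma funpow_mem:
  assumes "f \<in> K \<rightarrow> K" "u \<in> K"
  shows "(f ^^ n) u \<in> K"
  using assms by (induction n) auto

lemma funpow_fixed_point:
  assumes "f p = p"
  shows "(f ^^ n) p = p"
  using assms by (induction n) auto

lemma closed_fixed_points_on:
  assumes "closed K" "continuous_on K f"
  shows "closed (fixed_points_on K (f :: 'a::metric_space \<Rightarrow> 'a))"
proof -
  have "fixed_points_on K f = K \<inter> (\<lambda>u. dist (f u) u) -` {0}"
    by (auto simp: fixed_points_on_def)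
  also have "closed \<dots>"
    by (intro continuous_closed_preimage continuous_intros assms closed_singleton)
  finally show ?thesis .
qed

text \<open>Below \<open>M\<close> monotonicity gives the constant bound \<open>\<xi> M\<close>, and
  from \<open>M\<close> on the linear bound holds. Both are nonnegative, so their sum dominates
  everywhere.\<close>

lemma affine_bound_of_eventually_linear:
  fixes \<xi> :: "real \<Rightarrow> real"
  assumes "strict_mono_on {0..} \<xi>" "\<xi> \<in> {0..} \<rightarrow> {0..}"
    and "\<exists>M>0. \<exists>M'>0. \<forall>t\<ge>M. \<xi> t \<le> M' * t"
  shows "\<exists>C L. 0 \<le> C \<and> 0 \<le> L \<and> (\<forall>t\<ge>0. \<xi> t \<le> C + L * t)"
proof -
  obtain M M' where M: "M > 0" "M' > 0" "\<And>t. t \<ge> M \<Longrightarrow> \<xi> t \<le> M' * t"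
    using assms(3) by blast
  have C: "0 \<le> \<xi> M" using assms(2) M(1) by (auto simp: Pi_iff)
  have "\<xi> t \<le> \<xi> M + M' * t" if "t \<ge> 0" for t
  proof (cases "t < M")
    case True
    then have "\<xi> t < \<xi> M" using assms(1) that by (auto simp: strict_mono_on_def)
    moreover have "M' * t \<ge> 0" using M that by simp
    ultimately show ?thesis by linarith
  next
    case False
    then show ?thesis using M(3)[of t] C by simp
  qed
  with C M(2) show ?thesis by (intro exI[of _ "\<xi> M"] exI[of _ M']) auto
qed

lemma frequently_small_of_liminf_eq_0:
  fixes f :: "nat \<Rightarrow> real"
  assumes "liminf (\<lambda>n. ereal (f n)) = 0" "\<epsilon> > 0"
  shows "\<exists>n\<ge>N. f n < \<epsilon>"
proof (rule ccontr)
  assume "\<not> ?thesis"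
  then have "eventually (\<lambda>n. ereal \<epsilon> \<le> ereal (f n)) sequentially"
    by (auto simp: eventually_sequentially not_less)
  then have "ereal \<epsilon> \<le> liminf (\<lambda>n. ereal (f n))" by (rule Liminf_bounded)
  with assms show False by simp
qed

theorem theorem3p4:
  fixes W :: "'a::metric_space \<Rightarrow> 'a \<Rightarrow> real \<Rightarrow> 'a"
    and \<eta> :: "real \<Rightarrow> real \<Rightarrow> real"
    and K F :: "'a set"
    and m :: nat
    and T :: "nat \<Rightarrow> 'a \<Rightarrow> 'a"
    and k \<phi> :: "nat \<Rightarrow> nat \<Rightarrow> real"
    and \<xi> :: "nat \<Rightarrow> real \<Rightarrow> real"
    and \<alpha> :: "nat \<Rightarrow> real"
    and x :: "nat \<Rightarrow> 'a"
    and y :: "nat \<Rightarrow> nat \<Rightarrow> 'a"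
  assumes X: "hyperbolic_space W" "uniformly_convex W" "complete (UNIV :: 'a set)"
    and \<eta>: "modulus_of_uniform_convexity W \<eta>" "monotone_modulus \<eta>"
    and K: "K \<noteq> {}" "closed K" "W_convex W K"
    and m: "m \<ge> 1"
    and T_unif: "\<forall>i\<in>{1..m}. uniformly_continuous_on K (T i)"
    and T_tan: "\<forall>i\<in>{1..m}. total_asymptotically_nonexpansive_on K (T i) (k i) (\<phi> i) (\<xi> i)"
    and F: "F = (\<Inter>i\<in>{1..m}. fixed_points_on K (T i))" "F \<noteq> {}"
    and C1: "\<forall>i\<in>{1..m}. summable (\<lambda>n. k i (Suc n)) \<and> summable (\<lambda>n. \<phi> i (Suc n))"
    and C2: "\<forall>i\<in>{1..m}. \<exists>M>0. \<exists>M'>0. \<forall>t\<ge>M. \<xi> i t \<le> M' * t"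
    and \<alpha>: "\<forall>n\<ge>1. \<alpha> n \<in> {0..1}"
           "\<exists>a\<in>{0<..<1}. \<exists>b\<in>{0<..<1}. \<forall>n\<ge>1. \<alpha> n \<in> {a..b}"
    and x1: "x 1 \<in> K"
    and iter_one: "m = 1 \<Longrightarrow>
          \<forall>n\<ge>1. x (n + 1) = W (x n) ((T 1 ^^ n) (x n)) (\<alpha> n)"
    and iter_many: "m \<ge> 2 \<Longrightarrow>
          \<forall>n\<ge>1. x (n + 1) = W (x n) ((T 1 ^^ n) (y 1 n)) (\<alpha> n) \<and>
                (\<forall>j\<in>{1..m - 2}. y j n = W (x n) ((T (j + 1) ^^ n) (y (j + 1) n)) (\<alpha> n)) \<and>
                y (m - 1) n = W (x n) ((T m ^^ n) (x n)) (\<alpha> n)"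
  shows "(\<exists>p\<in>F. x \<longlonglongrightarrow> p) \<longleftrightarrow> liminf (\<lambda>n. ereal (infdist (x n) F)) = 0"
proof
  assume "\<exists>p\<in>F. x \<longlonglongrightarrow> p"
  then obtain p where p: "p \<in> F" "x \<longlonglongrightarrow> p" by blast
  have "(\<lambda>n. infdist (x n) F) \<longlonglongrightarrow> infdist p F" by (rule tendsto_infdist[OF p(2)])
  then have "(\<lambda>n. ereal (infdist (x n) F)) \<longlonglongrightarrow> ereal 0" using p(1) by simp
  then show "liminf (\<lambda>n. ereal (infdist (x n) F)) = 0"
    by (simp add: lim_imp_Liminf zero_ereal_def)
next
  assume lim0: "liminf (\<lambda>n. ereal (infdist (x n) F)) = 0"
  interpret hyperbolic_space W by (rule X(1))
  note tan = T_tan[unfolded total_asymptotically_nonexpansive_on_def]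
  have "\<forall>i\<in>{1..m}. \<exists>C L. 0 \<le> C \<and> 0 \<le> L \<and> (\<forall>t\<ge>0. \<xi> i t \<le> C + L * t)"
    using tan C2 by (intro ballI affine_bound_of_eventually_linear) auto
  then obtain C L where CL: "\<And>i. i \<in> {1..m} \<Longrightarrow> 0 \<le> C i" "\<And>i. i \<in> {1..m} \<Longrightarrow> 0 \<le> L i"
      "\<And>i t. i \<in> {1..m} \<Longrightarrow> 0 \<le> t \<Longrightarrow> \<xi> i t \<le> C i + L i * t"
    by metis
  have k0: "0 \<le> k i n" and \<phi>0: "0 \<le> \<phi> i n" if "i \<in> {1..m}" "n \<ge> 1" for i n
    using tan that by auto
  \<comment> \<open>Summing over the finite family makes the constants independent of
    \<open>i\<close> and keeps them summable. Each summand is nonnegative for n \<ge> 1, hence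
    bounded by the sum.\<close>
  define s where "s n = (\<Sum>i\<in>{1..m}. k i n * L i)" for n
  define e where "e n = (\<Sum>i\<in>{1..m}. k i n * C i + \<phi> i n)" for n
  have s0: "0 \<le> s n" and e0: "0 \<le> e n" if "n \<ge> 1" for n
    unfolding s_def e_def using k0 \<phi>0 CL that by (auto intro!: sum_nonneg)
  have s_sum: "summable (\<lambda>n. s (Suc n))" and e_sum: "summable (\<lambda>n. e (Suc n))"
    unfolding s_def e_def using C1
    by (auto intro!: summable_sum summable_add summable_mult2)
  have F_K: "p \<in> K" if "p \<in> F" for p
    using that F(1) m by (auto simp: fixed_points_on_def)
  have T_K: "(T i ^^ n) u \<in> K" if "i \<in> {1..m}" "u \<in> K" for i n u
    using tan that by (intro funpow_mem) auto
  have T_p: "dist ((T i ^^ n) u) p \<le> (1 + s n) * dist u p + e n"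
    if i: "i \<in> {1..m}" and n: "n \<ge> 1" and u: "u \<in> K" and p: "p \<in> F" for i n u p
  proof -
    have "(T i ^^ n) p = p"
      using p i F(1) by (intro funpow_fixed_point) (auto simp: fixed_points_on_def)
    then have "dist ((T i ^^ n) u) p \<le> dist u p + k i n * \<xi> i (dist u p) + \<phi> i n"
      using tan i n u F_K[OF p] by metis
    \<comment> \<open>The slope of the affine bound on \<open>\<xi> i\<close> goes into the factor
      \<open>s n\<close>, its constant term into the error \<open>e n\<close>.\<close>
    also have "\<dots> \<le> dist u p + k i n * (C i + L i * dist u p) + \<phi> i n"
      using CL(3)[OF i] k0[OF i n] by (simp add: mult_left_mono)
    also have "\<dots> = dist u p + (k i n * L i) * dist u p + (k i n * C i + \<phi> i n)"
      by (simp add: algebra_simps)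
    also have "\<dots> \<le> dist u p + s n * dist u p + e n"
    proof -
      have "k i n * L i \<le> s n" unfolding s_def
        using i n k0 CL(2) by (intro member_le_sum) auto
      moreover have "k i n * C i + \<phi> i n \<le> e n" unfolding e_def
        using i n k0 \<phi>0 CL(1) by (intro member_le_sum[where f = "\<lambda>i. k i n * C i + \<phi> i n"]) auto
      ultimately show ?thesis by (intro add_mono mult_right_mono) auto
    qed
    finally show ?thesis by (simp add: algebra_simps)
  qed
  have step: "x (Suc n) \<in> K \<and>
      dist (x (Suc n)) p \<le> (1 + s n) ^ m * (dist (x n) p + real m * e n)"
    if n: "n \<ge> 1" and x: "x n \<in> K" and p: "p \<in> F" for n p
  proof -
    \<comment> \<open>Reading \<open>x\<^sub>n\<^sub>+\<^sub>1\<close> as \<open>y\<^sub>0\<close> and \<open>x\<^sub>n\<close> as \<open>y\<^sub>m\<close> merges all cases of the scheme into one recursion.\<close>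
    define v where "v j = (if j = m then x n else if j = 0 then x (Suc n) else y j n)" for j
    have rec: "v j = W (v m) ((T (Suc j) ^^ n) (v (Suc j))) (\<alpha> n)" if "j < m" for j
    proof (cases "m = 1")
      case True
      with that iter_one n show ?thesis by (simp add: v_def)
    next
      case False
      then have it: "x (n + 1) = W (x n) ((T 1 ^^ n) (y 1 n)) (\<alpha> n)"
          "\<And>j. j \<in> {1..m - 2} \<Longrightarrow> y j n = W (x n) ((T (j + 1) ^^ n) (y (j + 1) n)) (\<alpha> n)"
          "y (m - 1) n = W (x n) ((T m ^^ n) (x n)) (\<alpha> n)"
        using iter_many m n by auto
      \<comment> \<open>These are the outermost, middle and innermost equations of the scheme. For m
        = 2 the middle range is empty.\<close>
      consider "j = 0" | "j \<in> {1..m - 2}" | "0 < j" "Suc j = m"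
        using \<open>j < m\<close> by fastforce
      then show ?thesis
      proof cases
        case 1
        then show ?thesis using it(1) False m by (auto simp: v_def)
      next
        case 2
        then show ?thesis using it(2)[OF 2] by (auto simp: v_def)
      next
        case 3
        then show ?thesis using it(3) by (auto simp: v_def)
      qed
    qed
    have "v (m - m) \<in> K \<and>
        dist (v (m - m)) p \<le> (1 + s n) ^ m * (dist (v m) p + real m * e n)"
      by (rule nested_Mann_estimate[where S = "\<lambda>i. T i ^^ n" and t = "\<alpha> n"])
        (use K(3) x \<alpha>(1) n s0 e0 rec T_K T_p p in \<open>auto simp: v_def[of m]\<close>)
    then show ?thesis using m by (simp add: v_def)
  qed
  \<comment> \<open>The value \<open>x 0\<close> is unconstrained, so from here on the sequence is
    shifted by one. Nonemptiness of F supplies the point p that \<open>step\<close> asks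
    for.\<close>
  have x_K: "x (Suc n) \<in> K" for n
    using x1 step F(2) by (induction n) auto
  \<comment> \<open>The inequality \<open>1 + s \<le> exp s\<close> turns the m-th power into the
    exponential factor of the Cauchy criterion, with exponents \<open>m * s\<close> that are still
    summable.\<close>
  have fejer: "dist (x (Suc (Suc n))) p
      \<le> exp (real m * s (Suc n)) * (dist (x (Suc n)) p + real m * e (Suc n))"
    if "p \<in> F" for n p
  proof -
    have "(1 + s (Suc n)) ^ m \<le> exp (s (Suc n)) ^ m"
      using s0[of "Suc n"] by (intro power_mono exp_ge_add_one_self) auto
    also have "\<dots> = exp (real m * s (Suc n))" by (simp add: exp_of_nat_mult)
    finally have "(1 + s (Suc n)) ^ m * (dist (x (Suc n)) p + real m * e (Suc n))
        \<le> exp (real m * s (Suc n)) * (dist (x (Suc n)) p + real m * e (Suc n))"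
      using e0[of "Suc n"] by (intro mult_right_mono) auto
    with step[of "Suc n" p] x_K that show ?thesis by force
  qed
  \<comment> \<open>Asking for an index beyond \<open>Suc N\<close> ensures that it is a successor,
    as the shifted sequence requires.\<close>
  have near: "\<exists>n\<ge>N. infdist (x (Suc n)) F < \<epsilon>" if "\<epsilon> > 0" for \<epsilon> N
    using frequently_small_of_liminf_eq_0[OF lim0 that, of "Suc N"]
    by (metis Suc_le_D Suc_le_mono)
  have "Cauchy (\<lambda>n. x (Suc n))"
    by (rule quasi_fejer_Cauchy[where z = "\<lambda>n. x (Suc n)" and F = F
          and a = "\<lambda>n. real m * s (Suc n)" and c = "\<lambda>n. real m * e (Suc n)"])
      (use fejer near F(2) s0 e0 s_sum e_sum in \<open>auto intro!: summable_mult\<close>)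
  then obtain q where q: "(\<lambda>n. x (Suc n)) \<longlonglongrightarrow> q"
    using X(3) unfolding complete_def by auto
  then have x_q: "x \<longlonglongrightarrow> q" by (simp add: filterlim_sequentially_Suc)
  \<comment> \<open>Convergence makes the lower limit a limit, so q has distance 0 from F, and F is
    closed and nonempty.\<close>
  have "(\<lambda>n. infdist (x n) F) \<longlonglongrightarrow> infdist q F" by (rule tendsto_infdist[OF x_q])
  then have "liminf (\<lambda>n. ereal (infdist (x n) F)) = ereal (infdist q F)"
    by (intro lim_imp_Liminf) auto
  with lim0 have "infdist q F = 0" by simp
  moreover have "closed F" unfolding F(1)
    using T_unif K(2)
    by (intro closed_INT ballI closed_fixed_points_on uniformly_continuous_imp_continuous) auto
  ultimately have "q \<in> F" using F(2) by (simp add: in_closed_iff_infdist_zero)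
  with x_q show "\<exists>p\<in>F. x \<longlonglongrightarrow> p" by blast
qed

end
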